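(* Let $G$ be a $\mathcal{B}_{a,b}$-graph satisfying Assumption A, with $X_a\setminus X_b=\{a_1,\dots,a_r\}$ and $X_b\setminus X_a=\{b_1,\dots,b_s\}$, and suppose: (1) there is a proper 2-coloring $f$ of $\tilde G$ coloring all vertices of $\mathcal{A}$ red and all vertices of $\mathcal{B}$ blue such that the relations $<_X$ and $<_Y$ associated with $f$ are partial orders; (2) the sets $\{N_Y(a_1),\dots,N_Y(a_r)\}$ and $\{N_Y(b_1),\dots,N_Y(b_s)\}$ are each totally ordered by inclusion (nested neighborhoods), and the rigid-free conditions hold. Then $G$ is square geometric.
   Context: $N_S(v)=N(v)\cap S$. A graph is square geometric if there is $p:V(G)\to\mathbb{R}^2$ with distinct $u,v$ adjacent iff $\|p(u)-p(v)\|_\infty\le1$. A binate interval graph is a graph whose vertex set can be partitioned into two sets each inducing a connected unit interval graph. A $\mathcal{B}_{a,b}$-graph is a binate interval graph whose vertex set can be partitioned into $X=X_a\cup X_b$ and $Y$, where $X_a,X_b,Y$ are cliques and $X_a\cap X_b\ne\emptyset$. A rigid pair is a pair $\{x_1y_1,x_2y_2\}$ of edges with $x_1,x_2\in X$, $y_1,y_2\in Y$ such that $x_1y_1y_2x_2$ is an induced 4-cycle; its chords are $x_1y_2,x_2y_1$. The chord graph $\tilde G$ has vertex set the non-edges $xy$ with $x\in X,y\in Y$; two are adjacent iff they are the two chords of a rigid pair. An $a$-vertex is a vertex $ay$ of $\tilde G$ with $a\in X_a\setminus X_b$; a $b$-vertex is $by$ with $b\in X_b\setminus X_a$. $\mathcal{A}$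 = non-isolated $a$-vertices with a neighbor in $\tilde G$ that is not an $a$-vertex; $\mathcal{B}$ = $b$-vertices with a neighbor in $\tilde G$ that is not a $b$-vertex. Assumption A: $\tilde G$ is connected; $0<|N_Y(v)|<|Y|$ for all $v\in(X_a\setminus X_b)\cup(X_b\setminus X_a)$; for every $b\in X_b\setminus X_a$ there is $u\in X$ with $N_Y(b)\not\subseteq N_Y(u)$; $\tilde G$ has an edge neither of whose ends is an $a$-vertex or a $b$-vertex. Relations associated with a proper 2-coloring $f:V(\tilde G)\to\{\text{red},\text{blue}\}$: $x<_Xx'$ if $x=x'$ or there is a rigid pair $\{xy,x'y'\}$ with $f(xy')=$ red and $f(x'y)=$ blue; $y<_Yy'$ if $y=y'$ or there is a rigid pair $\{xy,x'y'\}$ with $f(xy')=$ red and $f(x'y)=$ blue. A vertex $v\in X$ is rigid-free w.r.t. $S\subseteq X$ if no rigid pair $\{x_1y_1,x_2y_2\}$ has $\{x_1,x_2\}\subseteq S$ and $y_1,y_2\in N_Y(v)$. Rigid-free conditions: either every $a\in X_a\setminus X_b$ is rigid-free w.r.t. every set $\{x_1,x_2\}$ and every $\{x,b\}$ ($x,x_1,x_2\in X_a\cap X_b$, $b\in X_b\setminus X_a$), or every $b\in X_b\setminus X_a$ is rigid-free w.r.t. every set $\{x_1,x_2\}$ and every $\{x,a\}$ ($x,x_1,x_2\in X_a\cap X_b$, $a\in X_a\setminus X_b$).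
   Formalization: The formal theorem additionally assumes that no vertex of X_a∖X_b is adjacent to a vertex of X_b∖X_a (G[X] is the union of the two cliques); without this the claim fails, e.g. for a graph with r=2, s=1, |X_a∩X_b|=2, |Y|=3 in which only one of the a_i is adjacent to b_1. *)

theory Defs
  imports "HOL-Analysis.Analysis"
begin

text \<open>
  A graph is given by its vertex set \<open>V\<close> and its adjacency predicate \<open>E\<close>.  The predicates
  below that take a set of vertices and \<open>E\<close> only look at adjacencies inside that set, so that
  applying them to \<open>S \<subseteq> V\<close> speaks about the subgraph induced by \<open>S\<close>.
\<close>

definition simple_graph :: "'v set \<Rightarrow> ('v \<Rightarrow> 'v \<Rightarrow> bool) \<Rightarrow> bool" where
  "simple_graph V E \<longleftrightarrow>
     finite V \<and> (\<forall>u v. E u v \<longrightarrow> u \<in> V \<and> v \<in> V \<and> u \<noteq> v \<and> E v u)"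

definition clique :: "'v set \<Rightarrow> ('v \<Rightarrow> 'v \<Rightarrow> bool) \<Rightarrow> bool" where
  "clique K E \<longleftrightarrow> (\<forall>u\<in>K. \<forall>v\<in>K. u \<noteq> v \<longrightarrow> E u v)"

definition connected_graph :: "'v set \<Rightarrow> ('v \<Rightarrow> 'v \<Rightarrow> bool) \<Rightarrow> bool" where
  "connected_graph V E \<longleftrightarrow>
     V \<noteq> {} \<and> (\<forall>u\<in>V. \<forall>v\<in>V. (u, v) \<in> {(s, t). s \<in> V \<and> t \<in> V \<and> E s t}\<^sup>*)"

definition unit_interval_graph :: "'v set \<Rightarrow> ('v \<Rightarrow> 'v \<Rightarrow> bool) \<Rightarrow> bool" where
  "unit_interval_graph V E \<longleftrightarrow>
     (\<exists>p :: 'v \<Rightarrow> real. \<forall>u\<in>V. \<forall>v\<in>V. u \<noteq> v \<longrightarrow> (E u v \<longleftrightarrow> \<bar>p u - p v\<bar> \<le> 1))"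

definition square_geometric :: "'v set \<Rightarrow> ('v \<Rightarrow> 'v \<Rightarrow> bool) \<Rightarrow> bool" where
  "square_geometric V E \<longleftrightarrow>
     (\<exists>p :: 'v \<Rightarrow> real ^ 2. \<forall>u\<in>V. \<forall>v\<in>V. u \<noteq> v \<longrightarrow> (E u v \<longleftrightarrow> infnorm (p u - p v) \<le> 1))"

definition binate_interval_graph :: "'v set \<Rightarrow> ('v \<Rightarrow> 'v \<Rightarrow> bool) \<Rightarrow> bool" where
  "binate_interval_graph V E \<longleftrightarrow>
     (\<exists>S T. S \<union> T = V \<and> S \<inter> T = {} \<and>
        connected_graph S E \<and> unit_interval_graph S E \<and>
        connected_graph T E \<and> unit_interval_graph T E)"

text \<open>
  The cliques \<open>X\<^sub>a\<close> and \<open>X\<^sub>b\<close> make up \<open>X\<close> as a graph, not only as a set of vertices: no vertex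
  of \<open>X\<^sub>a - X\<^sub>b\<close> is adjacent to a vertex of \<open>X\<^sub>b - X\<^sub>a\<close>.
\<close>

definition Bab_graph ::
  "'v set \<Rightarrow> ('v \<Rightarrow> 'v \<Rightarrow> bool) \<Rightarrow> 'v set \<Rightarrow> 'v set \<Rightarrow> 'v set \<Rightarrow> bool" where
  "Bab_graph V E Xa Xb Y \<longleftrightarrow>
     simple_graph V E \<and> binate_interval_graph V E \<and>
     (Xa \<union> Xb) \<union> Y = V \<and> (Xa \<union> Xb) \<inter> Y = {} \<and>
     clique Xa E \<and> clique Xb E \<and> clique Y E \<and> Xa \<inter> Xb \<noteq> {} \<and>
     (\<forall>a\<in>Xa - Xb. \<forall>b\<in>Xb - Xa. \<not> E a b)"

definition nbhd :: "('v \<Rightarrow> 'v \<Rightarrow> bool) \<Rightarrow> 'v set \<Rightarrow> 'v \<Rightarrow> 'v set" where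
  "nbhd E S v = {w \<in> S. E v w}"

text \<open>
  \<open>rigid_pair E X Y x\<^sub>1 y\<^sub>1 x\<^sub>2 y\<^sub>2\<close> says that the edges \<open>x\<^sub>1y\<^sub>1\<close> and \<open>x\<^sub>2y\<^sub>2\<close> form a rigid pair; it is
  invariant under exchanging the two edges.
\<close>

definition rigid_pair ::
  "('v \<Rightarrow> 'v \<Rightarrow> bool) \<Rightarrow> 'v set \<Rightarrow> 'v set \<Rightarrow> 'v \<Rightarrow> 'v \<Rightarrow> 'v \<Rightarrow> 'v \<Rightarrow> bool" where
  "rigid_pair E X Y x1 y1 x2 y2 \<longleftrightarrow>
     x1 \<in> X \<and> x2 \<in> X \<and> y1 \<in> Y \<and> y2 \<in> Y \<and> x1 \<noteq> x2 \<and> y1 \<noteq> y2 \<and>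
     E x1 y1 \<and> E y1 y2 \<and> E y2 x2 \<and> E x2 x1 \<and> \<not> E x1 y2 \<and> \<not> E x2 y1"

text \<open>As \<open>X\<close> and \<open>Y\<close> are disjoint, a non-edge between them is represented by the pair \<open>(x, y)\<close>.\<close>

definition chord_vertices ::
  "('v \<Rightarrow> 'v \<Rightarrow> bool) \<Rightarrow> 'v set \<Rightarrow> 'v set \<Rightarrow> ('v \<times> 'v) set" where
  "chord_vertices E X Y = {(x, y). x \<in> X \<and> y \<in> Y \<and> \<not> E x y}"

definition chord_adj ::
  "('v \<Rightarrow> 'v \<Rightarrow> bool) \<Rightarrow> 'v set \<Rightarrow> 'v set \<Rightarrow> 'v \<times> 'v \<Rightarrow> 'v \<times> 'v \<Rightarrow> bool" where
  "chord_adj E X Y p q \<longleftrightarrow>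
     (\<exists>x1 y1 x2 y2. rigid_pair E X Y x1 y1 x2 y2 \<and> p = (x1, y2) \<and> q = (x2, y1))"

definition a_vertices ::
  "('v \<Rightarrow> 'v \<Rightarrow> bool) \<Rightarrow> 'v set \<Rightarrow> 'v set \<Rightarrow> 'v set \<Rightarrow> ('v \<times> 'v) set" where
  "a_vertices E Xa Xb Y = {p \<in> chord_vertices E (Xa \<union> Xb) Y. fst p \<in> Xa - Xb}"

definition b_vertices ::
  "('v \<Rightarrow> 'v \<Rightarrow> bool) \<Rightarrow> 'v set \<Rightarrow> 'v set \<Rightarrow> 'v set \<Rightarrow> ('v \<times> 'v) set" where
  "b_vertices E Xa Xb Y = {p \<in> chord_vertices E (Xa \<union> Xb) Y. fst p \<in> Xb - Xa}"

definition calA ::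
  "('v \<Rightarrow> 'v \<Rightarrow> bool) \<Rightarrow> 'v set \<Rightarrow> 'v set \<Rightarrow> 'v set \<Rightarrow> ('v \<times> 'v) set" where
  "calA E Xa Xb Y =
     {p \<in> a_vertices E Xa Xb Y. \<exists>q. chord_adj E (Xa \<union> Xb) Y p q \<and> q \<notin> a_vertices E Xa Xb Y}"

definition calB ::
  "('v \<Rightarrow> 'v \<Rightarrow> bool) \<Rightarrow> 'v set \<Rightarrow> 'v set \<Rightarrow> 'v set \<Rightarrow> ('v \<times> 'v) set" where
  "calB E Xa Xb Y =
     {p \<in> b_vertices E Xa Xb Y. \<exists>q. chord_adj E (Xa \<union> Xb) Y p q \<and> q \<notin> b_vertices E Xa Xb Y}"

definition assumption_A ::
  "('v \<Rightarrow> 'v \<Rightarrow> bool) \<Rightarrow> 'v set \<Rightarrow> 'v set \<Rightarrow> 'v set \<Rightarrow> bool" where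
  "assumption_A E Xa Xb Y \<longleftrightarrow>
     connected_graph (chord_vertices E (Xa \<union> Xb) Y) (chord_adj E (Xa \<union> Xb) Y) \<and>
     (\<forall>v \<in> (Xa - Xb) \<union> (Xb - Xa). 0 < card (nbhd E Y v) \<and> card (nbhd E Y v) < card Y) \<and>
     (\<forall>b \<in> Xb - Xa. \<exists>u \<in> Xa \<union> Xb. \<not> nbhd E Y b \<subseteq> nbhd E Y u) \<and>
     (\<exists>p q. chord_adj E (Xa \<union> Xb) Y p q \<and>
        p \<notin> a_vertices E Xa Xb Y \<union> b_vertices E Xa Xb Y \<and>
        q \<notin> a_vertices E Xa Xb Y \<union> b_vertices E Xa Xb Y)"

datatype colour = Red | Blue

definition proper_2_colouring :: "'c set \<Rightarrow> ('c \<Rightarrow> 'c \<Rightarrow> bool) \<Rightarrow> ('c \<Rightarrow> colour) \<Rightarrow> bool" where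
  "proper_2_colouring W adj f \<longleftrightarrow> (\<forall>p\<in>W. \<forall>q\<in>W. adj p q \<longrightarrow> f p \<noteq> f q)"

definition less_X ::
  "('v \<Rightarrow> 'v \<Rightarrow> bool) \<Rightarrow> 'v set \<Rightarrow> 'v set \<Rightarrow> ('v \<times> 'v \<Rightarrow> colour) \<Rightarrow> 'v rel" where
  "less_X E X Y f =
     {(x, x'). x \<in> X \<and> x' \<in> X \<and>
        (x = x' \<or> (\<exists>y y'. rigid_pair E X Y x y x' y' \<and> f (x, y') = Red \<and> f (x', y) = Blue))}"

definition less_Y ::
  "('v \<Rightarrow> 'v \<Rightarrow> bool) \<Rightarrow> 'v set \<Rightarrow> 'v set \<Rightarrow> ('v \<times> 'v \<Rightarrow> colour) \<Rightarrow> 'v rel" where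
  "less_Y E X Y f =
     {(y, y'). y \<in> Y \<and> y' \<in> Y \<and>
        (y = y' \<or> (\<exists>x x'. rigid_pair E X Y x y x' y' \<and> f (x, y') = Red \<and> f (x', y) = Blue))}"

definition rigid_free ::
  "('v \<Rightarrow> 'v \<Rightarrow> bool) \<Rightarrow> 'v set \<Rightarrow> 'v set \<Rightarrow> 'v \<Rightarrow> 'v set \<Rightarrow> bool" where
  "rigid_free E X Y v S \<longleftrightarrow>
     \<not> (\<exists>x1 y1 x2 y2. rigid_pair E X Y x1 y1 x2 y2 \<and>
          {x1, x2} \<subseteq> S \<and> y1 \<in> nbhd E Y v \<and> y2 \<in> nbhd E Y v)"

definition rigid_free_conditions ::
  "('v \<Rightarrow> 'v \<Rightarrow> bool) \<Rightarrow> 'v set \<Rightarrow> 'v set \<Rightarrow> 'v set \<Rightarrow> bool" where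
  "rigid_free_conditions E Xa Xb Y \<longleftrightarrow>
     (\<forall>a \<in> Xa - Xb.
        (\<forall>x1 \<in> Xa \<inter> Xb. \<forall>x2 \<in> Xa \<inter> Xb. rigid_free E (Xa \<union> Xb) Y a {x1, x2}) \<and>
        (\<forall>x \<in> Xa \<inter> Xb. \<forall>b \<in> Xb - Xa. rigid_free E (Xa \<union> Xb) Y a {x, b})) \<or>
     (\<forall>b \<in> Xb - Xa.
        (\<forall>x1 \<in> Xa \<inter> Xb. \<forall>x2 \<in> Xa \<inter> Xb. rigid_free E (Xa \<union> Xb) Y b {x1, x2}) \<and>
        (\<forall>x \<in> Xa \<inter> Xb. \<forall>a \<in> Xa - Xb. rigid_free E (Xa \<union> Xb) Y b {x, a}))"

end

theory Submission
  imports Defs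
begin

text \<open>
  By nestedness and connectedness of the chord graph all \<open>a\<close>-vertices are red and all
  \<open>b\<close>-vertices are blue. For a fixed colour, say that \<open>y\<close> precedes \<open>y'\<close> if some \<open>x\<close> is adjacent to
  \<open>y\<close> while \<open>xy'\<close> is a non-edge of that colour. Transitivity of \<open><\<^sub>Y\<close> makes this a strict partial
  order, and a linear extension of it places \<open>X\<close> and \<open>Y\<close> on a line so that the non-edges of this
  colour are separated while all edges are kept. The first coordinate realises the red
  non-edges, the second one the blue non-edges. If the vertices \<open>a\<close> are rigid-free, the order for
  red extends to \<open>Y \<union> (X\<^sub>b - X\<^sub>a)\<close>, where each \<open>b\<close> is treated as a vertex adjacent to exactly
  \<open>X\<^sub>a \<inter> X\<^sub>b\<close>; the first coordinate then also separates the non-edges \<open>ab\<close>. The other rigid-free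
  condition is the same situation with \<open>a\<close>, \<open>b\<close> and the colours exchanged.
\<close>

section \<open>Maximum norm in the plane and ranks of finite strict orders\<close>

lemma infnorm_2_le_iff:
  fixes x :: "real ^ 2"
  shows "infnorm x \<le> c \<longleftrightarrow> \<bar>x $ 1\<bar> \<le> c \<and> \<bar>x $ 2\<bar> \<le> c"
proof -
  have "{\<bar>x $ i\<bar> |i. i \<in> UNIV} = {\<bar>x $ 1\<bar>, \<bar>x $ 2\<bar>}"
    unfolding UNIV_2 by auto
  then have "infnorm x = Max {\<bar>x $ 1\<bar>, \<bar>x $ 2\<bar>}"
    by (simp add: infnorm_cart cSup_eq_Max)
  then show ?thesis by simp
qed

text \<open>Count predecessors: along \<open>T\<close> the set of predecessors grows strictly, and
  no element is its own predecessor, so dividing by \<open>card Q\<close> stays below 1.\<close>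

lemma strict_order_rank:
  fixes T :: "'q \<Rightarrow> 'q \<Rightarrow> bool"
  assumes "finite Q"
    and irrefl: "\<And>q. q \<in> Q \<Longrightarrow> \<not> T q q"
    and trans: "\<And>q r s. q \<in> Q \<Longrightarrow> r \<in> Q \<Longrightarrow> s \<in> Q \<Longrightarrow> T q r \<Longrightarrow> T r s \<Longrightarrow> T q s"
  shows "\<exists>g :: 'q \<Rightarrow> real. (\<forall>q\<in>Q. 0 \<le> g q \<and> g q < 1) \<and> (\<forall>q\<in>Q. \<forall>r\<in>Q. T q r \<longrightarrow> g q < g r)"
proof (intro exI conjI ballI impI)
  define D where "D q = {p \<in> Q. T p q}" for q
  define g where "g q = real (card (D q)) / real (card Q)" for q
  show "0 \<le> g q" for q by (simp add: g_def)
  show "g q < 1" if "q \<in> Q" for q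
  proof -
    have "D q \<subset> Q" using that irrefl by (auto simp: D_def)
    then have "card (D q) < card Q" using \<open>finite Q\<close> psubset_card_mono by blast
    then show ?thesis by (simp add: g_def)
  qed
  show "g q < g r" if "q \<in> Q" "r \<in> Q" "T q r" for q r
  proof -
    have "D q \<subseteq> D r" using trans[OF _ that(1,2) _ that(3)] by (auto simp: D_def)
    moreover have "q \<in> D r" "q \<notin> D q" using that irrefl[OF that(1)] by (auto simp: D_def)
    ultimately have "D q \<subset> D r" by blast
    moreover have "finite (D r)" using \<open>finite Q\<close> by (simp add: D_def)
    ultimately have "card (D q) < card (D r)" using psubset_card_mono by blast
    moreover have "0 < card Q" using that \<open>finite Q\<close> card_gt_0_iff by blast
    ultimately show ?thesis by (simp add: g_def divide_strict_right_mono)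
  qed
qed

section \<open>Placing two cliques on a line\<close>

text \<open>
  The map \<open>h\<close> represents a unit interval graph between the required edges \<open>F\<close> and the required
  non-edges \<open>R\<close> of two disjoint cliques \<open>P\<close> and \<open>Q\<close>.
\<close>

definition line_placement ::
  "'q set \<Rightarrow> 'q set \<Rightarrow> ('q \<Rightarrow> 'q \<Rightarrow> bool) \<Rightarrow> ('q \<Rightarrow> 'q \<Rightarrow> bool) \<Rightarrow> ('q \<Rightarrow> real) \<Rightarrow> bool" where
  "line_placement P Q F R h \<longleftrightarrow>
     (\<forall>u\<in>P. \<forall>v\<in>P. \<bar>h u - h v\<bar> \<le> 1) \<and> (\<forall>u\<in>Q. \<forall>v\<in>Q. \<bar>h u - h v\<bar> \<le> 1) \<and>
     (\<forall>p\<in>P. \<forall>q\<in>Q. (F p q \<longrightarrow> \<bar>h p - h q\<bar> \<le> 1) \<and> (R p q \<longrightarrow> 1 < \<bar>h p - h q\<bar>))"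

text \<open>The assumptions make "some \<open>p\<close> has \<open>F p q\<close> and
  \<open>R p r\<close>" a strict order on \<open>Q\<close>. Rank \<open>Q\<close> along it and put
  each \<open>p\<close> at its highest \<open>F\<close>-neighbour: its \<open>R\<close>-partners
  then lie strictly above it.\<close>

lemma line_placement_exists:
  fixes F R :: "'q \<Rightarrow> 'q \<Rightarrow> bool"
  assumes "finite Q" and disj: "P \<inter> Q = {}"
    and irrefl: "\<And>p q. p \<in> P \<Longrightarrow> q \<in> Q \<Longrightarrow> F p q \<Longrightarrow> R p q \<Longrightarrow> False"
    and trans: "\<And>p p' q r s. p \<in> P \<Longrightarrow> p' \<in> P \<Longrightarrow> q \<in> Q \<Longrightarrow> r \<in> Q \<Longrightarrow> s \<in> Q \<Longrightarrow>
       F p q \<Longrightarrow> R p r \<Longrightarrow> F p' r \<Longrightarrow> R p' s \<Longrightarrow> \<exists>u\<in>P. F u q \<and> R u s"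
  shows "\<exists>h. line_placement P Q F R h"
proof -
  have "\<exists>g :: 'q \<Rightarrow> real. (\<forall>q\<in>Q. 0 \<le> g q \<and> g q < 1) \<and>
      (\<forall>q\<in>Q. \<forall>r\<in>Q. (\<exists>p\<in>P. F p q \<and> R p r) \<longrightarrow> g q < g r)"
  proof (rule strict_order_rank[OF \<open>finite Q\<close>])
    show "\<not> (\<exists>p\<in>P. F p q \<and> R p q)" if "q \<in> Q" for q
      using irrefl[OF _ that] by blast
    show "\<exists>p\<in>P. F p q \<and> R p s" if "q \<in> Q" "r \<in> Q" "s \<in> Q"
      "\<exists>p\<in>P. F p q \<and> R p r" "\<exists>p\<in>P. F p r \<and> R p s" for q r s
      using trans[OF _ _ that(1-3)] that(4,5) by blast
  qed
  then obtain g :: "'q \<Rightarrow> real" where g01: "\<And>q. q \<in> Q \<Longrightarrow> 0 \<le> g q \<and> g q < 1"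
    and gmono: "\<And>q r. q \<in> Q \<Longrightarrow> r \<in> Q \<Longrightarrow> \<exists>p\<in>P. F p q \<and> R p r \<Longrightarrow> g q < g r"
    by blast
  define N where "N p = {q \<in> Q. F p q}" for p
  \<comment> \<open>Without \<open>F\<close>-neighbours any negative value lies below all ranks;
    -1/2 keeps \<open>l\<close> within an interval of length 3/2.\<close>
  define l where "l p = (if N p = {} then - 1/2 else Max (g ` N p))" for p
  have finN: "finite (N p)" for p using \<open>finite Q\<close> by (simp add: N_def)
  have l_edge: "g q \<le> l p" if "q \<in> Q" "F p q" for p q
    using that finN[of p] by (auto simp: l_def N_def)
  have l_red: "l p < g q" if "p \<in> P" "q \<in> Q" "R p q" for p q
  proof (cases "N p = {}")
    case True
    then show ?thesis using g01[of q] that by (simp add: l_def)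
  next
    case False
    then have "Max (g ` N p) \<in> g ` N p" using finN by simp
    then obtain r where "r \<in> N p" "Max (g ` N p) = g r" by blast
    then show ?thesis using False that gmono[of r q] by (auto simp: l_def N_def)
  qed
  have l01: "- 1/2 \<le> l p \<and> l p < 1" for p
  proof (cases "N p = {}")
    case False
    then have "Max (g ` N p) \<in> g ` N p" using finN by simp
    then obtain r where "r \<in> N p" "Max (g ` N p) = g r" by blast
    then show ?thesis using False g01[of r] by (auto simp: l_def N_def)
  qed (simp add: l_def)
  \<comment> \<open>The scaling maps [-1/2, 1) to [0, 1), so each clique fits in unit length. After
    the shift of \<open>P\<close>, \<open>h q - h p\<close> exceeds 1 iff
    \<open>l p < g q\<close>.\<close>
  define h where "h v = (if v \<in> P then (2 * l v + 1) / 3 - 1 else (2 * g v + 1) / 3)" for v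
  have hP: "h p = (2 * l p + 1) / 3 - 1" if "p \<in> P" for p
    using that by (simp add: h_def)
  have hQ: "h q = (2 * g q + 1) / 3" if "q \<in> Q" for q
    using that disj by (auto simp: h_def)
  show ?thesis
    unfolding line_placement_def
  proof (intro exI[of _ h] conjI ballI impI)
    show "\<bar>h u - h v\<bar> \<le> 1" if "u \<in> P" "v \<in> P" for u v
      using l01[of u] l01[of v] by (simp add: hP that abs_le_iff field_simps)
    show "\<bar>h u - h v\<bar> \<le> 1" if "u \<in> Q" "v \<in> Q" for u v
      using g01[OF that(1)] g01[OF that(2)] by (simp add: hQ that abs_le_iff field_simps)
    show "\<bar>h p - h q\<bar> \<le> 1" if "p \<in> P" "q \<in> Q" "F p q" for p q
      using l01[of p] g01[OF that(2)] l_edge[OF that(2,3)] by (simp add: hP hQ that abs_le_iff field_simps)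
    show "\<bar>h p - h q\<bar> > 1" if "p \<in> P" "q \<in> Q" "R p q" for p q
      using l_red[OF that] by (simp add: hP hQ that abs_if field_simps)
  qed
qed

section \<open>Colour classes of the non-edges\<close>

text \<open>
  \<open>R\<close> and \<open>S\<close> are the two colour classes of non-edges between \<open>X\<close> and \<open>Y\<close>; the assumptions are
  invariant under exchanging \<open>Xa\<close> with \<open>Xb\<close> and \<open>R\<close> with \<open>S\<close>.
\<close>

locale chord_colouring =
  fixes E :: "'v \<Rightarrow> 'v \<Rightarrow> bool" and Xa Xb Y :: "'v set" and R S :: "'v \<Rightarrow> 'v \<Rightarrow> bool"
  assumes finX: "finite (Xa \<union> Xb)" and finY: "finite Y" and disj: "(Xa \<union> Xb) \<inter> Y = {}"
    and sym: "\<And>u v. E u v \<Longrightarrow> E v u"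
    and cliques: "clique Xa E" "clique Xb E" "clique Y E"
    and non_ab: "\<And>a b. a \<in> Xa - Xb \<Longrightarrow> b \<in> Xb - Xa \<Longrightarrow> \<not> E a b"
    and R_nonedge: "\<And>x y. R x y \<Longrightarrow> x \<in> Xa \<and> y \<in> Y \<and> \<not> E x y"
    and S_nonedge: "\<And>x y. S x y \<Longrightarrow> x \<in> Xb \<and> y \<in> Y \<and> \<not> E x y"
    and coloured: "\<And>x y. x \<in> Xa \<union> Xb \<Longrightarrow> y \<in> Y \<Longrightarrow> \<not> E x y \<Longrightarrow> R x y \<noteq> S x y"
    and rigid_colour: "\<And>x y x' y'. rigid_pair E (Xa \<union> Xb) Y x y x' y' \<Longrightarrow> R x y' = S x' y"
    and R_chord: "\<And>x y. R x y \<Longrightarrow> \<exists>x' y'. rigid_pair E (Xa \<union> Xb) Y x y' x' y"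
    and S_chord: "\<And>x y. S x y \<Longrightarrow> \<exists>x' y'. rigid_pair E (Xa \<union> Xb) Y x y' x' y"
    and less_trans: "\<And>x1 x2 x3 x4 y1 y2 y3.
       rigid_pair E (Xa \<union> Xb) Y x1 y1 x2 y2 \<Longrightarrow> R x1 y2 \<Longrightarrow>
       rigid_pair E (Xa \<union> Xb) Y x3 y2 x4 y3 \<Longrightarrow> R x3 y3 \<Longrightarrow>
       \<exists>x x'. rigid_pair E (Xa \<union> Xb) Y x y1 x' y3 \<and> R x y3"
    and nested: "chain_subset (nbhd E Y ` (Xa - Xb))" "chain_subset (nbhd E Y ` (Xb - Xa))"
begin

lemma rigid_pair_sym:
  "rigid_pair E (Xa \<union> Xb) Y x y x' y' \<Longrightarrow> rigid_pair E (Xa \<union> Xb) Y x' y' x y"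
  unfolding rigid_pair_def using sym by blast

text \<open>Reading a rigid pair from its other edge exchanges its chords and thus the colours, so
  \<open>S\<close> orders \<open>Y\<close> in reverse to \<open>R\<close> and transitivity carries
  over.\<close>

lemma swap: "chord_colouring E Xb Xa Y S R"
proof (unfold_locales, unfold Un_commute[of Xb Xa])
  show "\<exists>x x'. rigid_pair E (Xa \<union> Xb) Y x y1 x' y3 \<and> S x y3"
    if "rigid_pair E (Xa \<union> Xb) Y x1 y1 x2 y2" "S x1 y2"
      "rigid_pair E (Xa \<union> Xb) Y x3 y2 x4 y3" "S x3 y3" for x1 x2 x3 x4 y1 y2 y3
  proof -
    have 1: "rigid_pair E (Xa \<union> Xb) Y x2 y2 x1 y1" "rigid_pair E (Xa \<union> Xb) Y x4 y3 x3 y2"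
      using that(1,3) rigid_pair_sym by blast+
    moreover have "R x2 y1" "R x4 y2"
      using rigid_colour[OF 1(1)] rigid_colour[OF 1(2)] that(2,4) by blast+
    ultimately obtain x x' where r: "rigid_pair E (Xa \<union> Xb) Y x y3 x' y1" "R x y1"
      using less_trans by blast
    then show ?thesis using rigid_colour[OF r(1)] rigid_pair_sym by blast
  qed
  show "S x y' = R x' y" if "rigid_pair E (Xa \<union> Xb) Y x y x' y'" for x y x' y'
    using rigid_colour[OF rigid_pair_sym[OF that]] by simp
  show "S x y \<noteq> R x y" if "x \<in> Xa \<union> Xb" "y \<in> Y" "\<not> E x y" for x y
    using coloured[OF that] by simp
  show "\<not> E a b" if "a \<in> Xb - Xa" "b \<in> Xa - Xb" for a b
    using non_ab[OF that(2,1)] sym by blast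
  show "E u v \<Longrightarrow> E v u" for u v by (fact sym)
qed (fact finX finY disj cliques R_nonedge S_nonedge R_chord S_chord nested)+

lemma rigid_pairI:
  assumes "x \<in> Xa \<and> x' \<in> Xa \<or> x \<in> Xb \<and> x' \<in> Xb" "y \<in> Y" "y' \<in> Y"
    and "E x y" "E x' y'" "\<not> E x y'" "\<not> E x' y"
  shows "rigid_pair E (Xa \<union> Xb) Y x y x' y'"
proof -
  have "x \<noteq> x'" "y \<noteq> y'" using assms by auto
  then show ?thesis using assms cliques sym unfolding rigid_pair_def clique_def by blast
qed

text \<open>The relations of \<open>x'\<close> to \<open>y2\<close> and \<open>y3\<close> need not
  come from a rigid pair on \<open>y2\<close> and \<open>y3\<close>, so \<open>less_trans\<close>
  does not apply directly. A counterexample forces \<open>x\<close> and \<open>x'\<close> into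
  \<open>Xa \<inter> Xb\<close>; a further vertex \<open>w\<close> then gives a colour clash,
  whether or not it is adjacent to \<open>y1\<close>.\<close>

lemma colour_precedes_trans:
  assumes "E x y1" "R x y2" "E x' y2" "R x' y3" "y1 \<in> Y"
  shows "\<exists>u\<in>Xa. E u y1 \<and> R u y3"
proof (rule ccontr)
  assume no: "\<not> ?thesis"
  note x = R_nonedge[OF assms(2)] and x' = R_nonedge[OF assms(4)]
  have "\<not> E x' y1" using no x' assms by blast
  have p12: "rigid_pair E (Xa \<union> Xb) Y x y1 x' y2"
    using rigid_pairI[of x x' y1 y2] x x' assms \<open>\<not> E x' y1\<close> by blast
  then have S1: "S x' y1" using rigid_colour assms by blast
  have not_R: "\<not> R x y3" using no x assms by blast
  have "\<not> E x y3"
  proof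
    assume "E x y3"
    then have "rigid_pair E (Xa \<union> Xb) Y x' y2 x y3"
      using rigid_pairI[of x' x y2 y3] x x' assms by blast
    then have "S x y2" using rigid_colour assms by blast
    then show False using coloured x assms by blast
  qed
  then have S3: "S x y3" using coloured not_R x x' by blast
  have C: "x \<in> Xa \<inter> Xb" "x' \<in> Xa \<inter> Xb" using x x' S1 S3 S_nonedge by blast+
  \<comment> \<open>By \<open>p12\<close>, \<open>y1\<close> is already below \<open>y2\<close>, so
    transitivity would produce the excluded \<open>u\<close>.\<close>
  have less23: False if r: "rigid_pair E (Xa \<union> Xb) Y v y2 w y3" "R v y3" for v w
  proof -
    obtain u u' where "rigid_pair E (Xa \<union> Xb) Y u y1 u' y3" "R u y3"
      using less_trans[OF p12 assms(2) r] by blast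
    then show False using no R_nonedge[of u y3] by (auto simp: rigid_pair_def)
  qed
  \<comment> \<open>\<open>wz\<close> is the chord opposite to \<open>x'y3\<close>, hence in
    \<open>S\<close>.\<close>
  obtain w z where wz: "rigid_pair E (Xa \<union> Xb) Y x' z w y3" using R_chord assms(4) by blast
  then have "w \<in> Xa \<union> Xb" "z \<in> Y" "E w y3" "E x' z" "\<not> E w z"
    using sym by (auto simp: rigid_pair_def)
  have "S w z" using rigid_colour wz assms by blast
  have "E w y2"
  proof (rule ccontr)
    assume "\<not> E w y2"
    then have "rigid_pair E (Xa \<union> Xb) Y x' y2 w y3"
      using rigid_pairI[of x' w y2 y3] C \<open>w \<in> Xa \<union> Xb\<close> \<open>E w y3\<close> x x' assms by blast
    then show False using less23 assms(4) by blast
  qed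
  show False
  proof (cases "E w y1")
    case True
    then have "rigid_pair E (Xa \<union> Xb) Y w y1 x' z"
      using rigid_pairI[of w x' y1 z] C \<open>w \<in> Xa \<union> Xb\<close> \<open>z \<in> Y\<close> \<open>E x' z\<close> \<open>\<not> E w z\<close>
        \<open>\<not> E x' y1\<close> assms by blast
    then have "R w z" using S1 rigid_colour by blast
    then show False using \<open>S w z\<close> coloured \<open>w \<in> Xa \<union> Xb\<close> \<open>z \<in> Y\<close> \<open>\<not> E w z\<close> by blast
  next
    case False
    \<comment> \<open>Both rigid pairs have the chord \<open>w y1\<close>, so \<open>x y2\<close>
      and \<open>x y3\<close> get the same colour.\<close>
    then have "rigid_pair E (Xa \<union> Xb) Y x y1 w y2" "rigid_pair E (Xa \<union> Xb) Y x y1 w y3"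
      using rigid_pairI[of x w y1 y2] rigid_pairI[of x w y1 y3] C \<open>w \<in> Xa \<union> Xb\<close> \<open>E w y2\<close>
        \<open>E w y3\<close> \<open>\<not> E x y3\<close> x x' assms by blast+
    then show False using rigid_colour assms(2) not_R by blast
  qed
qed

section \<open>The two coordinates\<close>

text \<open>One placement puts \<open>Xa\<close> against \<open>Y \<union> (Xb - Xa)\<close>, the
  other \<open>Xa \<union> Xb\<close> against \<open>Y\<close>. A non-edge between \<open>Y\<close>
  and \<open>Xb - Xa\<close> is always in \<open>S\<close>, so the first coordinate may keep these
  two sets close together.\<close>

lemma square_geometric_if_a_rigid_free:
  assumes free: "\<And>a x x'. a \<in> Xa - Xb \<Longrightarrow> x \<in> Xa \<inter> Xb \<Longrightarrow> x' \<in> Xb \<Longrightarrow>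
      rigid_free E (Xa \<union> Xb) Y a {x, x'}"
  shows "square_geometric (Xa \<union> Xb \<union> Y) E"
proof -
  \<comment> \<open>This is where rigid-freeness enters: \<open>a\<close> has no \<open>S\<close>
    non-edges, which forces all \<open>Y\<close>-neighbours of \<open>x\<close> to be neighbours of
    \<open>a\<close>. The rigid pair with chord \<open>xy\<close> then has both its
    \<open>Y\<close>-ends in the neighbourhood of \<open>a\<close>.\<close>
  have low_up: False if a: "a \<in> Xa - Xb" "E a y" and x: "x \<in> Xa \<inter> Xb" "R x y" for a x y
  proof -
    have y: "y \<in> Y" "\<not> E x y" using R_nonedge x by blast+
    have sub: "E a z" if "z \<in> Y" "E x z" for z
    proof (rule ccontr)
      assume "\<not> E a z"
      then have "rigid_pair E (Xa \<union> Xb) Y x z a y"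
        using rigid_pairI[of x a z y] a x y that by blast
      then have "S a z" using rigid_colour x by blast
      then show False using S_nonedge a by blast
    qed
    obtain x' y' where r: "rigid_pair E (Xa \<union> Xb) Y x y' x' y" using R_chord x by blast
    then have "x' \<in> Xb" using rigid_colour x S_nonedge by blast
    moreover have "y' \<in> Y" "E x y'" using r by (auto simp: rigid_pair_def)
    ultimately show False
      using free[OF a(1) x(1)] r sub y a unfolding rigid_free_def nbhd_def by blast
  qed
  let ?A = "Xa - Xb" and ?B = "Xb - Xa" and ?C = "Xa \<inter> Xb"
  have nest: False if "a \<in> ?A" "a' \<in> ?A" "E a y" "\<not> E a' y" "E a' y'" "\<not> E a y'" "y \<in> Y" "y' \<in> Y"
    for a a' y y'
  proof -
    have "nbhd E Y a \<subseteq> nbhd E Y a' \<or> nbhd E Y a' \<subseteq> nbhd E Y a"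
      using nested(1) that(1,2) unfolding chain_subset_def by blast
    then show False using that by (auto simp: nbhd_def)
  qed
  define R' where "R' p q \<longleftrightarrow> R p q \<or> p \<in> ?A \<and> q \<in> ?B" for p q
  have XaR: "R a y" if "a \<in> ?A" "y \<in> Y" "\<not> E a y" for a y
    using coloured S_nonedge that by blast
  have finQ: "finite (Y \<union> ?B)" using finX finY by simp
  have disjQ: "Xa \<inter> (Y \<union> ?B) = {}" using disj by blast
  have BY: "q \<notin> Y" if "q \<in> Xb" for q using that disj by blast
  have irr: False if "p \<in> Xa" "q \<in> Y \<union> ?B" "E p q" "R' p q" for p q
    using that R_nonedge non_ab unfolding R'_def by blast
  \<comment> \<open>If \<open>r\<close> is in \<open>?B\<close>, the witness is \<open>p\<close>,
    since \<open>low_up\<close> excludes the edge \<open>ps\<close>. If otherwise \<open>q\<close>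
    or \<open>s\<close> is in \<open>?B\<close>, the witness is \<open>p'\<close>, since
    \<open>low_up\<close> puts \<open>p\<close> and \<open>p'\<close> both in \<open>?C\<close> or
    both in \<open>?A\<close>; in the latter case nestedness gives the edge
    \<open>p'q\<close>.\<close>
  have tr: "\<exists>u\<in>Xa. E u q \<and> R' u s"
    if p: "p \<in> Xa" "p' \<in> Xa" and Q: "q \<in> Y \<union> ?B" "r \<in> Y \<union> ?B" "s \<in> Y \<union> ?B"
      and e: "E p q" "R' p r" "E p' r" "R' p' s" for p p' q r s
  proof (cases "r \<in> ?B")
    case True
    then have pp: "p \<in> ?A" "p' \<in> ?C" using p e R_nonedge BY non_ab unfolding R'_def by blast+
    then have q: "q \<in> Y" using e Q non_ab by blast
    have s: "R p' s" "s \<in> Y" using e pp R_nonedge unfolding R'_def by blast+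
    then have "\<not> E p s" using low_up pp by blast
    then show ?thesis using XaR pp s e unfolding R'_def by blast
  next
    case False
    then have r: "r \<in> Y" "R p r" using Q e unfolding R'_def by blast+
    show ?thesis
    proof (cases "q \<in> ?B")
      case True
      then have pC: "p \<in> ?C" using e p non_ab by blast
      then have "p' \<in> ?C" using low_up e r p by blast
      moreover have "E p' q" using \<open>p' \<in> ?C\<close> True cliques(2) by (auto simp: clique_def)
      ultimately show ?thesis using e by blast
    next
      case False
      then have q: "q \<in> Y" using Q by blast
      show ?thesis
      proof (cases "s \<in> ?B")
        case True
        then have a': "p' \<in> ?A" using e R_nonedge BY unfolding R'_def by blast
        then have a: "p \<in> ?A" using low_up e r p by blast
        have "E p' q" using nest[OF a a' e(1) _ e(3)] r q R_nonedge by blast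
        then show ?thesis using a' True unfolding R'_def by blast
      next
        case False
        then have "R p' s" using e unfolding R'_def by blast
        then show ?thesis using colour_precedes_trans[OF e(1) r(2) e(3)] q unfolding R'_def by blast
      qed
    qed
  qed
  have "\<exists>h. line_placement Xa (Y \<union> ?B) E R' h"
    by (rule line_placement_exists[OF finQ disjQ]) (fact irr tr)+
  then obtain h1 :: "'v \<Rightarrow> real" where
      h1P: "\<And>u v. u \<in> Xa \<Longrightarrow> v \<in> Xa \<Longrightarrow> \<bar>h1 u - h1 v\<bar> \<le> 1"
    and h1Q: "\<And>u v. u \<in> Y \<union> ?B \<Longrightarrow> v \<in> Y \<union> ?B \<Longrightarrow> \<bar>h1 u - h1 v\<bar> \<le> 1"
    and h1E: "\<And>p q. p \<in> Xa \<Longrightarrow> q \<in> Y \<union> ?B \<Longrightarrow> E p q \<Longrightarrow> \<bar>h1 p - h1 q\<bar> \<le> 1"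
    and h1R: "\<And>p q. p \<in> Xa \<Longrightarrow> q \<in> Y \<union> ?B \<Longrightarrow> R' p q \<Longrightarrow> \<bar>h1 p - h1 q\<bar> > 1"
    unfolding line_placement_def by blast
  interpret swapped: chord_colouring E Xb Xa Y S R by (rule swap)
  have irr2: False if "p \<in> Xa \<union> Xb" "q \<in> Y" "E p q" "S p q" for p q
    using that S_nonedge by blast
  have tr2: "\<exists>u\<in>Xa \<union> Xb. E u q \<and> S u s"
    if "q \<in> Y" "E p q" "S p r" "E p' r" "S p' s" for p p' q r s
    using swapped.colour_precedes_trans that by blast
  \<comment> \<open>\<open>Xa \<union> Xb\<close> need not be a clique, but \<open>h1\<close>
    already separates the non-edges \<open>ab\<close>.\<close>
  have "\<exists>h. line_placement (Xa \<union> Xb) Y E S h"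
    by (rule line_placement_exists[OF finY disj]) (use irr2 tr2 in \<open>blast+\<close>)
  then obtain h2 :: "'v \<Rightarrow> real" where
      h2P: "\<And>u v. u \<in> Xa \<union> Xb \<Longrightarrow> v \<in> Xa \<union> Xb \<Longrightarrow> \<bar>h2 u - h2 v\<bar> \<le> 1"
    and h2Q: "\<And>u v. u \<in> Y \<Longrightarrow> v \<in> Y \<Longrightarrow> \<bar>h2 u - h2 v\<bar> \<le> 1"
    and h2E: "\<And>p q. p \<in> Xa \<union> Xb \<Longrightarrow> q \<in> Y \<Longrightarrow> E p q \<Longrightarrow> \<bar>h2 p - h2 q\<bar> \<le> 1"
    and h2S: "\<And>p q. p \<in> Xa \<union> Xb \<Longrightarrow> q \<in> Y \<Longrightarrow> S p q \<Longrightarrow> \<bar>h2 p - h2 q\<bar> > 1"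
    unfolding line_placement_def by blast
  define near where "near u v \<longleftrightarrow> \<bar>h1 u - h1 v\<bar> \<le> 1 \<and> \<bar>h2 u - h2 v\<bar> \<le> 1" for u v
  have near_sym: "near u v = near v u" for u v by (simp add: near_def abs_minus_commute)
  have E_sym: "E u v = E v u" for u v using sym by blast
  have xy: "E u v \<longleftrightarrow> near u v" if "u \<in> Xa \<union> Xb" "v \<in> Y" for u v
  proof
    show "near u v" if "E u v"
      using that \<open>u \<in> Xa \<union> Xb\<close> \<open>v \<in> Y\<close> h1E[of u v] h1Q[of u v] h2E[of u v]
      unfolding near_def by blast
    show "E u v" if "near u v"
    proof (rule ccontr)
      assume "\<not> E u v"
      then consider "R u v" | "S u v" using coloured \<open>u \<in> Xa \<union> Xb\<close> \<open>v \<in> Y\<close> by blast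
      then show False
      proof cases
        case 1
        then have "\<bar>h1 u - h1 v\<bar> > 1"
          using h1R[of u v] R_nonedge[of u v] by (auto simp: R'_def)
        then show False using that by (simp add: near_def)
      next
        case 2
        then have "\<bar>h2 u - h2 v\<bar> > 1" using h2S[of u v] \<open>u \<in> Xa \<union> Xb\<close> \<open>v \<in> Y\<close> by blast
        then show False using that by (simp add: near_def)
      qed
    qed
  qed
  have ab: "E u v \<longleftrightarrow> near u v" if "u \<in> Xa" "v \<in> ?B" for u v
  proof (cases "u \<in> Xb")
    case True
    then have "E u v" using that cliques(2) by (auto simp: clique_def)
    then show ?thesis using h1E[of u v] h2P[of u v] that unfolding near_def by blast
  next
    case False
    then have "\<bar>h1 u - h1 v\<bar> > 1" using h1R[of u v] that by (auto simp: R'_def)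
    then show ?thesis using non_ab[of u v] that False by (simp add: near_def)
  qed
  have same: "E u v \<longleftrightarrow> near u v"
    if "u \<noteq> v" "u \<in> Xa \<and> v \<in> Xa \<or> u \<in> ?B \<and> v \<in> ?B \<or> u \<in> Y \<and> v \<in> Y" for u v
  proof -
    have "E u v" using that cliques by (auto simp: clique_def)
    moreover have "near u v"
      using that h1P[of u v] h1Q[of u v] h2P[of u v] h2Q[of u v] unfolding near_def by blast
    ultimately show ?thesis by simp
  qed
  have all: "E u v \<longleftrightarrow> near u v" if uv: "u \<in> Xa \<union> Xb \<union> Y" "v \<in> Xa \<union> Xb \<union> Y" "u \<noteq> v" for u v
  proof -
    consider "u \<in> Xa \<union> Xb \<and> v \<in> Y" | "v \<in> Xa \<union> Xb \<and> u \<in> Y" | "u \<in> Xa \<and> v \<in> ?B"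
      | "v \<in> Xa \<and> u \<in> ?B" | "u \<in> Xa \<and> v \<in> Xa \<or> u \<in> ?B \<and> v \<in> ?B \<or> u \<in> Y \<and> v \<in> Y"
      using uv by blast
    then show ?thesis
    proof cases
      case 2
      then show ?thesis using xy[of v u] near_sym[of u v] E_sym[of u v] by blast
    next
      case 4
      then show ?thesis using ab[of v u] near_sym[of u v] E_sym[of u v] by blast
    qed (use xy ab same[OF uv(3)] in blast)+
  qed
  define pos :: "'v \<Rightarrow> real ^ 2" where "pos v = vector [h1 v, h2 v]" for v
  have "infnorm (pos u - pos v) \<le> 1 \<longleftrightarrow> near u v" for u v
    by (simp add: infnorm_2_le_iff near_def pos_def)
  then show ?thesis using all unfolding square_geometric_def by blast
qed

end

section \<open>From the graph hypotheses to the colour classes\<close>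

text \<open>A walk from \<open>v\<close> to a second vertex starts with an edge at \<open>v\<close>.
  This will make every non-edge between \<open>X\<close> and \<open>Y\<close> a chord of some rigid
  pair.\<close>

lemma chord_adj_not_isolated:
  assumes conn: "connected_graph (chord_vertices E X Y) (chord_adj E X Y)"
    and edge: "chord_adj E X Y p q" "p \<in> chord_vertices E X Y" "q \<in> chord_vertices E X Y" "p \<noteq> q"
    and v: "v \<in> chord_vertices E X Y"
  shows "\<exists>w. chord_adj E X Y v w"
proof -
  obtain w where w: "w \<in> chord_vertices E X Y" "w \<noteq> v" using edge by metis
  then have "(v, w) \<in> {(s, t). s \<in> chord_vertices E X Y \<and> t \<in> chord_vertices E X Y \<and>
      chord_adj E X Y s t}\<^sup>*"
    using conn v by (simp add: connected_graph_def)
  then show ?thesis using w(2) by (cases rule: converse_rtranclE) auto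
qed

theorem theorem4p2:
  fixes V :: "'v set" and E :: "'v \<Rightarrow> 'v \<Rightarrow> bool" and Xa Xb Y :: "'v set"
  assumes "Bab_graph V E Xa Xb Y"
    and "assumption_A E Xa Xb Y"
    and "\<exists>f. proper_2_colouring (chord_vertices E (Xa \<union> Xb) Y) (chord_adj E (Xa \<union> Xb) Y) f \<and>
           (\<forall>p \<in> calA E Xa Xb Y. f p = Red) \<and> (\<forall>p \<in> calB E Xa Xb Y. f p = Blue) \<and>
           partial_order_on (Xa \<union> Xb) (less_X E (Xa \<union> Xb) Y f) \<and>
           partial_order_on Y (less_Y E (Xa \<union> Xb) Y f)"
    and "chain_subset (nbhd E Y ` (Xa - Xb))"
    and "chain_subset (nbhd E Y ` (Xb - Xa))"
    and "rigid_free_conditions E Xa Xb Y"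
  shows "square_geometric V E"
proof -
  let ?X = "Xa \<union> Xb"
  let ?W = "chord_vertices E ?X Y"
  let ?rp = "rigid_pair E ?X Y"
  obtain f where f: "proper_2_colouring ?W (chord_adj E ?X Y) f"
    and fA: "\<And>p. p \<in> calA E Xa Xb Y \<Longrightarrow> f p = Red"
    and fB: "\<And>p. p \<in> calB E Xa Xb Y \<Longrightarrow> f p = Blue"
    and po: "partial_order_on Y (less_Y E ?X Y f)"
    using assms(3) by blast
  have V: "V = ?X \<union> Y" and disj: "?X \<inter> Y = {}" and finV: "finite V"
    and sym: "\<And>u v. E u v \<Longrightarrow> E v u"
    and cliques: "clique Xa E" "clique Xb E" "clique Y E"
    and non_ab: "\<And>a b. a \<in> Xa - Xb \<Longrightarrow> b \<in> Xb - Xa \<Longrightarrow> \<not> E a b"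
    using assms(1) unfolding Bab_graph_def simple_graph_def by auto
  have W: "(x, y') \<in> ?W \<and> (x', y) \<in> ?W" if "?rp x y x' y'" for x y x' y'
    using that by (auto simp: rigid_pair_def chord_vertices_def)
  have flip: "f (x, y') = Red \<longleftrightarrow> f (x', y) = Blue" if "?rp x y x' y'" for x y x' y'
  proof -
    have "chord_adj E ?X Y (x, y') (x', y)" using that unfolding chord_adj_def by blast
    then have "f (x, y') \<noteq> f (x', y)" using f W[OF that] unfolding proper_2_colouring_def by blast
    then show ?thesis by (cases "f (x, y')"; cases "f (x', y)") auto
  qed
  obtain p q where pq: "chord_adj E ?X Y p q" and conn: "connected_graph ?W (chord_adj E ?X Y)"
    using assms(2) unfolding assumption_A_def by blast
  have "p \<in> ?W" "q \<in> ?W" "p \<noteq> q"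
    using pq W unfolding chord_adj_def rigid_pair_def by blast+
  then have chord: "\<exists>x' y'. ?rp x y' x' y" if "(x, y) \<in> ?W" for x y
    using chord_adj_not_isolated[OF conn pq _ _ _ that] unfolding chord_adj_def by blast
  \<comment> \<open>The two \<open>X\<close>-ends of a rigid pair have incomparable neighbourhoods
    in \<open>Y\<close>.\<close>
  have nest: False if "?rp x y' x' y" "x \<in> D" "x' \<in> D" "chain_subset (nbhd E Y ` D)" for x y x' y' D
  proof -
    have "nbhd E Y x \<subseteq> nbhd E Y x' \<or> nbhd E Y x' \<subseteq> nbhd E Y x"
      using that unfolding chain_subset_def by blast
    then show False using that(1) sym unfolding nbhd_def rigid_pair_def by blast
  qed
  \<comment> \<open>By \<open>nest\<close>, the opposite chord is not an \<open>a\<close>-vertex, so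
    \<open>(x, y)\<close> lies in \<open>calA\<close>; \<open>b_blue\<close> is analogous.\<close>
  have a_red: "f (x, y) = Red" if xy: "(x, y) \<in> ?W" "x \<in> Xa - Xb" for x y
  proof -
    obtain x' y' where r: "?rp x y' x' y" using chord xy by blast
    then have "x' \<notin> Xa - Xb" using nest assms(4) xy by blast
    then have "(x, y) \<in> calA E Xa Xb Y"
      using r xy unfolding calA_def a_vertices_def chord_adj_def by auto
    then show ?thesis by (rule fA)
  qed
  have b_blue: "f (x, y) = Blue" if xy: "(x, y) \<in> ?W" "x \<in> Xb - Xa" for x y
  proof -
    obtain x' y' where r: "?rp x y' x' y" using chord xy by blast
    then have "x' \<notin> Xb - Xa" using nest assms(5) xy by blast
    then have "(x, y) \<in> calB E Xa Xb Y"
      using r xy unfolding calB_def b_vertices_def chord_adj_def by auto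
    then show ?thesis by (rule fB)
  qed
  define R where "R x y \<longleftrightarrow> (x, y) \<in> ?W \<and> f (x, y) = Red" for x y
  define S where "S x y \<longleftrightarrow> (x, y) \<in> ?W \<and> f (x, y) = Blue" for x y
  have less: "(y, y') \<in> less_Y E ?X Y f \<and> y \<noteq> y'" if "?rp x y x' y'" "R x y'" for x y x' y'
    using that flip[OF that(1)] unfolding less_Y_def R_def rigid_pair_def by blast
  interpret chord_colouring E Xa Xb Y R S
  proof
    show "R x y \<Longrightarrow> x \<in> Xa \<and> y \<in> Y \<and> \<not> E x y" for x y
      using b_blue[of x y] by (auto simp: R_def chord_vertices_def)
    show "S x y \<Longrightarrow> x \<in> Xb \<and> y \<in> Y \<and> \<not> E x y" for x y
      using a_red[of x y] by (auto simp: S_def chord_vertices_def)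
    show "R x y \<noteq> S x y" if "x \<in> ?X" "y \<in> Y" "\<not> E x y" for x y
      using that by (cases "f (x, y)") (auto simp: R_def S_def chord_vertices_def)
    show "R x y' = S x' y" if "?rp x y x' y'" for x y x' y'
      using flip[OF that] W[OF that] by (simp add: R_def S_def)
    show "\<exists>x x'. ?rp x y1 x' y3 \<and> R x y3"
      if "?rp x1 y1 x2 y2" "R x1 y2" "?rp x3 y2 x4 y3" "R x3 y3" for x1 x2 x3 x4 y1 y2 y3
    proof -
      have 1: "(y1, y2) \<in> less_Y E ?X Y f" "(y2, y3) \<in> less_Y E ?X Y f" "y1 \<noteq> y2"
        using less that by blast+
      \<comment> \<open>As \<open>less_Y\<close> includes equality, antisymmetry is needed to
        exclude \<open>y1 = y3\<close> before a rigid pair can be extracted.\<close>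
      have "trans (less_Y E ?X Y f)" "antisym (less_Y E ?X Y f)"
        using po by (auto simp: partial_order_on_def preorder_on_def)
      then have "(y1, y3) \<in> less_Y E ?X Y f" "y1 \<noteq> y3"
        using 1 by (meson transD, metis antisymD)
      then obtain x x' where "?rp x y1 x' y3" "f (x, y3) = Red" unfolding less_Y_def by blast
      then show ?thesis using W unfolding R_def by blast
    qed
  qed (use finV V disj sym cliques non_ab chord assms(4,5) in \<open>auto simp: R_def S_def\<close>)
  \<comment> \<open>Letting \<open>x'\<close> range over a whole clique merges the two clauses of
    each rigid-free condition.\<close>
  consider
    "\<And>a x x'. a \<in> Xa - Xb \<Longrightarrow> x \<in> Xa \<inter> Xb \<Longrightarrow> x' \<in> Xb \<Longrightarrow> rigid_free E ?X Y a {x, x'}"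
    | "\<And>b x x'. b \<in> Xb - Xa \<Longrightarrow> x \<in> Xa \<inter> Xb \<Longrightarrow> x' \<in> Xa \<Longrightarrow> rigid_free E ?X Y b {x, x'}"
    using assms(6) unfolding rigid_free_conditions_def by blast
  then show ?thesis
  proof cases
    case 1
    then show ?thesis using square_geometric_if_a_rigid_free V by simp
  next
    case 2
    interpret swapped: chord_colouring E Xb Xa Y S R by (rule swap)
    show ?thesis
      using swapped.square_geometric_if_a_rigid_free 2 V by (simp add: Un_commute Int_commute)
  qed
qed

end
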